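(* Let $H$ be an upper entropy function. Then for all integers $n,m\ge1$ and all probability vectors $(p_1,\dots,p_n)\in\Omega_n$ and $(q_1,\dots,q_m)\in\Omega_m$, $$H(p_1q_1,\dots,p_1q_m,\,p_2q_1,\dots,p_2q_m,\,\dots,\,p_nq_1,\dots,p_nq_m)\le H(p_1,\dots,p_n)+H(q_1,\dots,q_m).$$
   Context: For each integer $N\ge 1$ let $\Omega_N=\{(p_1,\dots,p_N): p_i\ge 0,\ \sum_{i=1}^N p_i=1\}$, and let $\Omega=\bigcup_{N\ge1}\Omega_N$. A function $H:\Omega\to\mathbb{R}$ is called an upper entropy function if it satisfies: (i) Continuity: the restriction of $H$ to each $\Omega_N$ is continuous, and $H(p_1,\dots,p_N)=0$ if and only if there is $k$ with $p_k=1$. (ii) Symmetry: $H(p_1,\dots,p_N)$ is invariant under permutations of its arguments. (iii) Increasing property: if $(p_1,\dots,p_N)\in\Omega_N$, $1\le n\le N$, $m\ge1$, $q_1,\dots,q_m\ge 0$ and $p_n=\sum_{i=1}^m q_i$, then $$0\le H(p_1,\dots,p_{n-1},q_1,\dots,q_m,p_{n+1},\dots,p_N)-H(p_1,\dots,p_N)\le p_n H\Big(\frac{q_1}{p_n},\dots,\frac{q_m}{p_n}\Big),$$ where the right-hand side is read as $0$ when $p_n=0$. (iv) Maximum: for every $N\ge1$ and $(p_1,\dots,p_N)\in\Omega_N$, $H(p_1,\dots,p_N)\le H(\frac1N,\dots,\frac1N)$. *)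

theory Defs
  imports "HOL-Analysis.Analysis"
begin

(* The tuple (p_1, ..., p_N) is the list p of length N, so that p_k is p ! (k - 1). *)
definition Omega :: "nat \<Rightarrow> real list set" where
  "Omega N = {p. length p = N \<and> (\<forall>x\<in>set p. 0 \<le> x) \<and> sum_list p = 1}"

(* H is only constrained on the union of the Omega N with N >= 1. Continuity is with respect to
   the subspace topology of Omega N in R^N, where x in R^N corresponds to the list
   map x [0..<N]. *)
definition entropy_continuity :: "(real list \<Rightarrow> real) \<Rightarrow> bool" where
  "entropy_continuity H \<longleftrightarrow>
    (\<forall>N\<ge>1.
      continuous_map (subtopology (Euclidean_space N) {x. map x [0..<N] \<in> Omega N})
        euclideanreal (\<lambda>x. H (map x [0..<N])) \<and>
      (\<forall>p\<in>Omega N. H p = 0 \<longleftrightarrow> (\<exists>k<N. p ! k = 1)))"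

definition entropy_symmetry :: "(real list \<Rightarrow> real) \<Rightarrow> bool" where
  "entropy_symmetry H \<longleftrightarrow>
    (\<forall>N\<ge>1. \<forall>p\<in>Omega N. \<forall>\<pi>. \<pi> permutes {..<N} \<longrightarrow> H (permute_list \<pi> p) = H p)"

(* as = (p_1, ..., p_{n-1}), x = p_n, bs = (p_{n+1}, ..., p_N). *)
definition entropy_increasing :: "(real list \<Rightarrow> real) \<Rightarrow> bool" where
  "entropy_increasing H \<longleftrightarrow>
    (\<forall>N\<ge>1. \<forall>as x bs qs.
      as @ x # bs \<in> Omega N \<longrightarrow> length qs \<ge> 1 \<longrightarrow> (\<forall>q\<in>set qs. 0 \<le> q) \<longrightarrow> x = sum_list qs \<longrightarrow>
        0 \<le> H (as @ qs @ bs) - H (as @ x # bs) \<and>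
        H (as @ qs @ bs) - H (as @ x # bs)
          \<le> (if x = 0 then 0 else x * H (map (\<lambda>q. q / x) qs)))"

definition entropy_maximum :: "(real list \<Rightarrow> real) \<Rightarrow> bool" where
  "entropy_maximum H \<longleftrightarrow>
    (\<forall>N\<ge>1. \<forall>p\<in>Omega N. H p \<le> H (replicate N (1 / real N)))"

definition upper_entropy :: "(real list \<Rightarrow> real) \<Rightarrow> bool" where
  "upper_entropy H \<longleftrightarrow>
    entropy_continuity H \<and> entropy_symmetry H \<and> entropy_increasing H \<and> entropy_maximum H"

end

theory Submission
  imports Defs
begin

text \<open>
  The product vector arises from \<open>p\<close> by splitting its entries one at a time, each entry \<open>x\<close>
  being replaced by the block \<open>x * q\<^sub>1, \<dots>, x * q\<^sub>m\<close>. Renormalising such a block gives back \<open>q\<close>,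
  whatever \<open>x \<noteq> 0\<close> is, so the increasing property bounds the gain of entropy in this step by
  \<open>x * H q\<close>. Since the entries of \<open>p\<close> add up to \<open>1\<close>, the total gain is at most \<open>H q\<close>.
\<close>

text \<open>
  For \<open>x = 0\<close> the increasing property bounds the gain by \<open>0\<close> outright, which agrees with
  \<open>x * H q\<close>; hence no case distinction is left in the bound.
\<close>

lemma split_entry_le:
  assumes inc: "entropy_increasing H"
    and "N \<ge> 1" "as @ x # bs \<in> Omega N" and "m \<ge> 1" "q \<in> Omega m"
  shows "H (as @ map (\<lambda>b. x * b) q @ bs) \<le> H (as @ x # bs) + x * H q"
proof -
  let ?xq = "map (\<lambda>b. x * b) q"
  have "0 \<le> x" using assms(3) by (auto simp: Omega_def)
  have "length ?xq \<ge> 1" "\<forall>c\<in>set ?xq. 0 \<le> c" "x = sum_list ?xq"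
    using assms(4,5) \<open>0 \<le> x\<close> by (auto simp: Omega_def sum_list_const_mult)
  then have "H (as @ ?xq @ bs) - H (as @ x # bs)
      \<le> (if x = 0 then 0 else x * H (map (\<lambda>c. c / x) ?xq))"
    using inc assms(2,3) unfolding entropy_increasing_def by blast
  also have "\<dots> = x * H q"
    by (simp add: o_def)
  finally show ?thesis by simp
qed

lemma split_entry_in_Omega:
  assumes "as @ x # bs \<in> Omega N" and "q \<in> Omega m"
  shows "as @ map (\<lambda>b. x * b) q @ bs \<in> Omega (length as + m + length bs)"
  using assms by (auto simp: Omega_def sum_list_const_mult)

text \<open>
  The prefix \<open>as\<close> holds the blocks already split: every intermediate list has to be a
  probability vector for the increasing property to apply, so the induction over the entries
  still to be split has to carry it along.
\<close>

lemma split_entries_le: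
  assumes inc: "entropy_increasing H" and m: "m \<ge> 1" and q: "q \<in> Omega m"
    and "as @ ys \<in> Omega N"
  shows "H (as @ concat (map (\<lambda>a. map (\<lambda>b. a * b) q) ys)) \<le> H (as @ ys) + sum_list ys * H q"
  using \<open>as @ ys \<in> Omega N\<close>
proof (induction ys arbitrary: as N)
  case Nil
  then show ?case by simp
next
  case (Cons x ys)
  let ?as = "as @ map (\<lambda>b. x * b) q"
  have N: "N \<ge> 1" using Cons.prems by (auto simp: Omega_def)
  have "?as @ ys \<in> Omega (length as + m + length ys)"
    using split_entry_in_Omega[OF Cons.prems q] by simp
  from Cons.IH[OF this]
  have "H (?as @ concat (map (\<lambda>a. map (\<lambda>b. a * b) q) ys)) \<le> H (?as @ ys) + sum_list ys * H q" .
  moreover have "H (?as @ ys) \<le> H (as @ x # ys) + x * H q"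
    using split_entry_le[OF inc N Cons.prems m q] by simp
  ultimately show ?case by (simp add: distrib_right)
qed

theorem mainTheorem2:
  fixes H :: "real list \<Rightarrow> real" and n m :: nat and p q :: "real list"
  assumes "upper_entropy H"
    and "n \<ge> 1" and "m \<ge> 1"
    and "p \<in> Omega n" and "q \<in> Omega m"
  shows "H (concat (map (\<lambda>a. map (\<lambda>b. a * b) q) p)) \<le> H p + H q"
proof -
  have "entropy_increasing H" using assms(1) by (simp add: upper_entropy_def)
  from split_entries_le[OF this assms(3,5), of "[]" p n] show ?thesis
    using assms(4) by (simp add: Omega_def)
qed

end
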